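(* Consider a contiguous integral deformation of the braid arrangement in $V_{n-1}$, defined by the intervals $[\alpha(i,j),\beta(i,j)]$, satisfying $$\beta(i,k)\le \beta(i,j)+\beta(j,k)+1\quad\text{for all triples of distinct } i,j,k\in\{1,\ldots,n\}.$$ Then any valid associated weighted digraph is $m$-acyclic if and only if it contains no $m$-ascending cycle of length at most four.
   Context: $V_{n-1}=\{x\in\mathbb{R}^n: x_1+\cdots+x_n=0\}$. A contiguous integral deformation of the braid arrangement consists of the hyperplanes $x_i-x_j=c$ in $V_{n-1}$, $1\le i<j\le n$, $c\in[\alpha(i,j),\beta(i,j)]$, where for each $i<j$, $\alpha(i,j)\le\beta(i,j)$ are integers and $[\alpha,\beta]=\{\alpha,\alpha+1,\ldots,\beta\}$. The notation is extended to all ordered pairs by $\alpha(j,i)=-\beta(i,j)$ and $\beta(j,i)=-\alpha(i,j)$ for $i<j$. A weighted digraph on $\{1,\ldots,n\}$ is a valid associated weighted digraph if for each $i<j$ exactly one of the following holds: (1) there is no edge $i\rightarrow j$ and there is exactly one edge $j\rightarrow i$, of weight $-\alpha(i,j)$; (2) there is exactly one edge $i\rightarrow j$, of weight $w$, and exactly one edge $j\rightarrow i$, of weight $-w-1$, for some integer $w\in[\alpha(i,j),\beta(i,j)-1]$; (3) there is exactly one edge $i\rightarrow j$, of weight $\beta(i,j)$, and there is no edge $j\rightarrow i$. An $m$-ascending cycle is a directed cycle whose total weight is nonnegative; a weighted digraph is $m$-acyclic if it contains no $m$-ascending cycle. The length of a cycle is its number of edges. *)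

theory Defs
  imports Complex_Main "HOL-Library.FuncSet" "Graph_Theory.Arc_Walk"
begin

section \<open>Contiguous integral deformations of the braid arrangement\<close>

text \<open>
  \<open>sum_zero_space n\<close> is the space $V_{n-1}$. Vectors of $\mathbb{R}^n$ are functions on
  \<open>{1..n}\<close>, i.e. elements of \<open>nat \<Rightarrow> real\<close> that are \<open>undefined\<close> outside \<open>{1..n}\<close>.
\<close>
definition sum_zero_space :: "nat \<Rightarrow> (nat \<Rightarrow> real) set" where
  "sum_zero_space n = {x. x \<in> extensional {1..n} \<and> (\<Sum>i = 1..n. x i) = 0}"

definition difference_hyperplane :: "nat \<Rightarrow> nat \<Rightarrow> nat \<Rightarrow> int \<Rightarrow> (nat \<Rightarrow> real) set" where
  "difference_hyperplane n i j c = {x \<in> sum_zero_space n. x i - x j = of_int c}"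

text \<open>
  \<open>\<A>\<close> is the deformation given by the intervals \<open>{\<alpha> i j..\<beta> i j}\<close>. Only the values of \<open>\<alpha>\<close> and
  \<open>\<beta>\<close> at pairs \<open>1 \<le> i < j \<le> n\<close> are data.
\<close>
definition contiguous_integral_deformation ::
  "nat \<Rightarrow> (nat \<Rightarrow> nat \<Rightarrow> int) \<Rightarrow> (nat \<Rightarrow> nat \<Rightarrow> int) \<Rightarrow> (nat \<Rightarrow> real) set set \<Rightarrow> bool" where
  "contiguous_integral_deformation n \<alpha> \<beta> \<A> \<longleftrightarrow>
     (\<forall>i j. 1 \<le> i \<and> i < j \<and> j \<le> n \<longrightarrow> \<alpha> i j \<le> \<beta> i j) \<and>
     \<A> = {difference_hyperplane n i j c | i j c.
            1 \<le> i \<and> i < j \<and> j \<le> n \<and> c \<in> {\<alpha> i j..\<beta> i j}}"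

text \<open>
  The extension of \<open>\<beta>\<close> to ordered pairs of distinct indices: $\beta(j,i) = -\alpha(i,j)$ for
  $i < j$. The value at \<open>i = j\<close> has no meaning and is never used.
\<close>
definition extended_beta ::
  "(nat \<Rightarrow> nat \<Rightarrow> int) \<Rightarrow> (nat \<Rightarrow> nat \<Rightarrow> int) \<Rightarrow> nat \<Rightarrow> nat \<Rightarrow> int" where
  "extended_beta \<alpha> \<beta> i j = (if i < j then \<beta> i j else - \<alpha> j i)"

section \<open>Associated weighted digraphs\<close>

text \<open>
  A weighted digraph is a digraph \<open>G\<close>, in which parallel arcs and loops are possible, together
  with a weight function \<open>w\<close> on its arcs.
\<close>
definition arcs_between :: "('a, 'e) pre_digraph \<Rightarrow> 'a \<Rightarrow> 'a \<Rightarrow> 'e set" where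
  "arcs_between G u v = {e \<in> arcs G. tail G e = u \<and> head G e = v}"

definition unique_arc_of_weight ::
  "('a, 'e) pre_digraph \<Rightarrow> ('e \<Rightarrow> int) \<Rightarrow> 'a \<Rightarrow> 'a \<Rightarrow> int \<Rightarrow> bool" where
  "unique_arc_of_weight G w u v c \<longleftrightarrow> (\<exists>e. arcs_between G u v = {e} \<and> w e = c)"

definition backward_arc_only ::
  "('a, 'e) pre_digraph \<Rightarrow> ('e \<Rightarrow> int) \<Rightarrow> 'a \<Rightarrow> 'a \<Rightarrow> int \<Rightarrow> bool" where
  "backward_arc_only G w i j a \<longleftrightarrow>
     arcs_between G i j = {} \<and> unique_arc_of_weight G w j i (- a)"

definition arcs_both_ways ::
  "('a, 'e) pre_digraph \<Rightarrow> ('e \<Rightarrow> int) \<Rightarrow> 'a \<Rightarrow> 'a \<Rightarrow> int \<Rightarrow> int \<Rightarrow> bool" where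
  "arcs_both_ways G w i j a b \<longleftrightarrow>
     (\<exists>c \<in> {a..b - 1}. unique_arc_of_weight G w i j c \<and> unique_arc_of_weight G w j i (- c - 1))"

definition forward_arc_only ::
  "('a, 'e) pre_digraph \<Rightarrow> ('e \<Rightarrow> int) \<Rightarrow> 'a \<Rightarrow> 'a \<Rightarrow> int \<Rightarrow> bool" where
  "forward_arc_only G w i j b \<longleftrightarrow>
     unique_arc_of_weight G w i j b \<and> arcs_between G j i = {}"

text \<open>
  The three alternatives exclude each other, so their disjunction says that exactly one holds.
  Loops are not constrained.
\<close>
definition valid_associated_digraph ::
  "nat \<Rightarrow> (nat \<Rightarrow> nat \<Rightarrow> int) \<Rightarrow> (nat \<Rightarrow> nat \<Rightarrow> int) \<Rightarrow>
   (nat, 'e) pre_digraph \<Rightarrow> ('e \<Rightarrow> int) \<Rightarrow> bool" where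
  "valid_associated_digraph n \<alpha> \<beta> G w \<longleftrightarrow>
     wf_digraph G \<and> verts G = {1..n} \<and>
     (\<forall>i j. 1 \<le> i \<and> i < j \<and> j \<le> n \<longrightarrow>
        backward_arc_only G w i j (\<alpha> i j) \<or>
        arcs_both_ways G w i j (\<alpha> i j) (\<beta> i j) \<or>
        forward_arc_only G w i j (\<beta> i j))"

text \<open>
  The cycles of \<^const>\<open>pre_digraph.cycle\<close> are nonempty arc lists that repeat no vertex except
  for returning to the start, and their length is the number of arcs. Loops and pairs of
  opposite arcs are cycles.
\<close>
definition m_ascending_cycle ::
  "('a, 'e) pre_digraph \<Rightarrow> ('e \<Rightarrow> int) \<Rightarrow> 'e list \<Rightarrow> bool" where
  "m_ascending_cycle G w p \<longleftrightarrow> pre_digraph.cycle G p \<and> 0 \<le> (\<Sum>e\<leftarrow>p. w e)"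

definition m_acyclic :: "('a, 'e) pre_digraph \<Rightarrow> ('e \<Rightarrow> int) \<Rightarrow> bool" where
  "m_acyclic G w \<longleftrightarrow> \<not> (\<exists>p. m_ascending_cycle G w p)"

end

theory Submission
  imports Defs
begin

text \<open>
  Write $\beta$ for the extended function on ordered pairs. Suppose that a shortest $m$-ascending
  cycle has length $m \ge 5$ and total weight $W \ge 0$. Let $u$ and $v$ be two of its vertices
  that are not neighbours on it; they cut it into a path from $u$ to $v$ and a path from $v$ to
  $u$. An arc $u \to v$ and the second path form a shorter cycle, which has negative weight, and
  so do an arc $v \to u$ and the first path. If both arcs were present, their weights would add
  up to $-1$, and the two shorter cycles would have total weight $W - 1 \ge -1$; but two negative
  integers add up to at most $-2$. So there is exactly one arc between $u$ and $v$, a one-way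
  chord. Being one-way, the chord $u \to v$ has weight $\beta(u,v)$, so
  $\beta(u,v) \le -1 - d(v,u)$, where $d$ denotes the weight along the cycle
  (\<open>valid_associated_digraph_one_way\<close>).

  Two chords $u \to v \to k$ cannot join neighbours $u$ and $k$ of the cycle. The hypothesis
  $\beta(u,k) \le \beta(u,v) + \beta(v,k) + 1$ would make $\beta(u,k)$ smaller than the lower
  bound that the cycle arc between $u$ and $k$ imposes on it. Hence all chords at a vertex point
  the same way: moving the other end of a chord one step along the cycle does not change its
  direction. So every vertex is a source or a sink for the chords, and the chords form a bipartite
  graph. That is impossible: the complement of a cycle of length at least five contains an odd
  cycle (\<open>no_long_cycle_with_one_way_chords\<close>).

  The cycle is unrolled into a periodic sequence of arcs indexed by the natural numbers, with the
  partial sums $S$ of the weights. Then $d(v_i, v_j) = S_j - S_i$ whenever $i < j < i + m$, the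
  complementary path runs from $j$ to $i + m$, and no position on the cycle needs special
  treatment.
\<close>

section \<open>Chords of a long cycle\<close>

text \<open>
  Here \<open>v\<close> is the unrolled vertex sequence of a cycle of length \<open>m\<close> and weight \<open>W\<close>, and \<open>S\<close> the
  partial sums of its arc weights. Each alternative in \<open>chord\<close> stands for a chord in one direction;
  by \<open>pair\<close> they exclude each other. By \<open>triangle\<close> a chord keeps its direction when one end moves
  along the cycle, so \<open>v\<close> consists of sources and sinks, and chords join sources to sinks. For
  \<open>m \<ge> 5\<close> both \<open>v (i + 2)\<close> and \<open>v (i + 3)\<close> are joined to \<open>v i\<close> by chords, so consecutive vertices
  have the same kind, which contradicts the chord from \<open>v 2\<close> to \<open>v 4\<close>.
\<close>
lemma no_long_cycle_with_one_way_chords: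
  fixes v :: "nat \<Rightarrow> 'v" and S :: "nat \<Rightarrow> int" and b :: "'v \<Rightarrow> 'v \<Rightarrow> int"
  assumes m: "5 \<le> m"
    and per: "\<And>i. v (i + m) = v i"
    and dist: "\<And>i j. i < j \<Longrightarrow> j < i + m \<Longrightarrow> v i \<noteq> v j"
    and S: "\<And>i. S (i + m) = S i + W" and W: "0 \<le> W"
    and triangle: "\<And>i j k. v i \<noteq> v j \<Longrightarrow> v j \<noteq> v k \<Longrightarrow> v i \<noteq> v k \<Longrightarrow>
           b (v i) (v k) \<le> b (v i) (v j) + b (v j) (v k) + 1"
    and pair: "\<And>i j. v i \<noteq> v j \<Longrightarrow> 0 \<le> b (v i) (v j) + b (v j) (v i)"
    and arc: "\<And>i. S (Suc i) - S i \<le> b (v i) (v (Suc i))"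
      "\<And>i. - (S (Suc i) - S i) \<le> b (v (Suc i)) (v i)"
    and chord: "\<And>i j. i + 2 \<le> j \<Longrightarrow> j + 2 \<le> i + m \<Longrightarrow>
           b (v j) (v i) \<le> - 1 - (S j - S i) \<or> b (v i) (v j) \<le> - 1 - (S (i + m) - S j)"
  shows False
proof -
  \<comment> \<open>The chord between \<open>v i\<close> and \<open>v j\<close> points to \<open>v i\<close>; since \<open>v (i + m) = v i\<close>, the opposite
    direction is \<open>R j (i + m)\<close>.\<close>
  define R where "R i j \<longleftrightarrow> b (v j) (v i) \<le> - 1 - (S j - S i)" for i j
  have one_way: "R j (i + m) \<longleftrightarrow> \<not> R i j" if "i + 2 \<le> j" "j + 2 \<le> i + m" for i j
    using chord[OF that] pair[of i j] dist[of i j] that per[of i] S[of i] W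
    unfolding R_def by force
  have step: "R i (Suc j) \<longleftrightarrow> R i j" if ij: "i + 2 \<le> j" "j + 3 \<le> i + m" for i j
  proof -
    have ne: "v i \<noteq> v j" "v i \<noteq> v (Suc j)" "v j \<noteq> v (Suc j)"
      using dist[of i j] dist[of i "Suc j"] dist[of j "Suc j"] ij m by auto
    have "R i (Suc j)" if "R i j"
    proof (rule ccontr)
      assume "\<not> R i (Suc j)"
      \<comment> \<open>Then \<open>v j \<rightarrow> v i \<rightarrow> v (Suc j)\<close> are chords, and \<open>triangle\<close> puts \<open>b (v j) (v (Suc j))\<close> below
        the weight of the cycle arc.\<close>
      then have "R (Suc j) (i + m)" using one_way[of i "Suc j"] ij by simp
      then show False
        using that triangle[of j i "Suc j"] ne arc(1)[of j] S[of i] W per[of i]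
        unfolding R_def by force
    qed
    moreover have "R i j" if "R i (Suc j)"
    proof (rule ccontr)
      assume "\<not> R i j"
      \<comment> \<open>Now the chords are \<open>v (Suc j) \<rightarrow> v i \<rightarrow> v j\<close>, against the direction of the cycle arc, and
        the second bound in \<open>arc\<close> is violated.\<close>
      then have "R j (i + m)" using one_way[of i j] ij by simp
      then show False
        using that triangle[of "Suc j" i j] ne arc(2)[of j] S[of i] W per[of i]
        unfolding R_def by force
    qed
    ultimately show ?thesis by blast
  qed
  define sink where "sink i \<longleftrightarrow> R i (i + 2)" for i
  have sink_const: "R i j \<longleftrightarrow> sink i" if "i + 2 \<le> j" "j + 2 \<le> i + m" for i j
    using that
  proof (induction j rule: dec_induct)
    case base
    then show ?case by (simp add: sink_def)
  next
    case (step j)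
    then show ?case using \<open>\<And>i j. _ \<Longrightarrow> _ \<Longrightarrow> R i (Suc j) \<longleftrightarrow> R i j\<close>[of i j] by simp
  qed
  have alternate: "sink j \<longleftrightarrow> \<not> sink i" if "i + 2 \<le> j" "j + 2 \<le> i + m" for i j
    using one_way[OF that] sink_const[OF that] sink_const[of j "i + m"] that by simp
  show False
    using alternate[of 0 2] alternate[of 0 3] alternate[of 1 3] alternate[of 1 4]
      alternate[of 2 4] m by simp
qed

section \<open>Cycles as periodic arc sequences\<close>

definition periodic_arc :: "'e list \<Rightarrow> nat \<Rightarrow> 'e" where
  "periodic_arc p i = p ! (i mod length p)"

lemma periodic_arc_add_length: "periodic_arc p (i + length p) = periodic_arc p i"
  by (simp add: periodic_arc_def)

lemma map_periodic_arc: "map (periodic_arc p) [0..<length p] = p"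
  by (rule nth_equalityI) (auto simp: periodic_arc_def)

context wf_digraph
begin

text \<open>
  Distinctness of the vertices of a cycle is stated in terms of its heads; this lemma transfers it
  to the tails, by which the periodic sequence is indexed.
\<close>
lemma closed_awalk_heads:
  assumes "awalk u p u" "p \<noteq> []"
  shows "map (head G) p = map (tail G) (rotate1 p)"
proof -
  have "tail G (hd p) = u" "head G (last p) = u"
    using awends_of_awalk[OF assms(1)] assms(2) by (simp_all add: awalk_verts_conv hd_map hd_append)
  moreover have "tail G (hd p) # map (head G) p = map (tail G) p @ [head G (last p)]"
    using awalk_verts_conv'[of u p u] awalk_verts_conv[of u p] assms by (auto simp: awalk_def)
  ultimately show ?thesis using assms(2) by (cases p) auto
qed

lemma
  assumes "cycle p"
  shows cycle_periodic_arc_in_arcs: "periodic_arc p i \<in> arcs G"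
    and cycle_periodic_arc_head: "head G (periodic_arc p i) = tail G (periodic_arc p (Suc i))"
    and cycle_periodic_arc_tail_neq:
      "i < j \<Longrightarrow> j < i + length p \<Longrightarrow> tail G (periodic_arc p i) \<noteq> tail G (periodic_arc p j)"
proof -
  obtain u where u: "awalk u p u" "distinct (tl (awalk_verts u p))" and ne: "p \<noteq> []"
    using assms by (auto simp: cycle_def)
  have lt: "k mod length p < length p" for k using ne by simp
  show "periodic_arc p i \<in> arcs G"
    using u lt[of i] by (auto simp: periodic_arc_def awalk_def)
  note heads = closed_awalk_heads[OF u(1) ne]
  have "map (head G) p ! (i mod length p) = map (tail G) (rotate1 p) ! (i mod length p)"
    by (simp add: heads)
  then show "head G (periodic_arc p i) = tail G (periodic_arc p (Suc i))"
    using lt[of i] by (simp add: periodic_arc_def nth_rotate1 mod_Suc_eq)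
  have "distinct (map (head G) p)"
    using u ne awalk_verts_conv'[of u p u] by (simp add: awalk_def)
  then have dist: "distinct (map (tail G) p)"
    unfolding heads by (simp flip: rotate1_map)
  assume ij: "i < j" "j < i + length p"
  have "i mod length p \<noteq> j mod length p"
  proof
    assume "i mod length p = j mod length p"
    then have "length p dvd j - i" using ij mod_eq_dvd_iff_nat[of i j "length p"] by simp
    then show False using ij by (auto dest: dvd_imp_le)
  qed
  then show "tail G (periodic_arc p i) \<noteq> tail G (periodic_arc p j)"
    using dist lt[of i] lt[of j] by (auto simp: periodic_arc_def distinct_conv_nth)
qed

text \<open>This is how a chord produces a shorter cycle.\<close>
lemma cycle_segment_closed_by_arc:
  assumes arcs: "\<And>k. e k \<in> arcs G" and link: "\<And>k. head G (e k) = tail G (e (Suc k))"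
    and inj: "inj_on (\<lambda>k. tail G (e k)) {i..j}" and "i \<le> j"
    and g: "g \<in> arcs G" "tail G g = tail G (e j)" "head G g = tail G (e i)"
  shows "cycle (map e [i..<j] @ [g])"
proof -
  have seg: "awalk (tail G (e i)) (map e [i..<j]) (tail G (e j))"
    using \<open>i \<le> j\<close>
  proof (induction j rule: dec_induct)
    case base
    then show ?case using arcs by (simp add: awalk_Nil_iff)
  next
    case (step j)
    then show ?case
      using awalk_appendI[OF step.IH arc_implies_awalk[OF arcs[of j]]] by (simp add: link)
  qed
  then have walk: "awalk (tail G (e i)) (map e [i..<j] @ [g]) (tail G (e i))"
    using awalk_appendI[OF seg] arc_implies_awalk[OF g(1)] g by simp
  have "map (tail G) (map e [i..<j] @ [g]) = map (\<lambda>k. tail G (e k)) [i..<Suc j]"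
    using \<open>i \<le> j\<close> g by simp
  moreover have "distinct (map (\<lambda>k. tail G (e k)) [i..<Suc j])"
    using inj by (simp add: distinct_map atLeastLessThanSuc_atLeastAtMost del: upt_Suc)
  ultimately have "distinct (map (tail G) (map e [i..<j] @ [g]))" by simp
  then have "distinct (map (head G) (map e [i..<j] @ [g]))"
    unfolding closed_awalk_heads[OF walk snoc_eq_iff_butlast[THEN iffD1, THEN conjunct1, OF refl]]
    by (simp flip: rotate1_map)
  then show ?thesis
    using walk awalk_verts_conv'[of "tail G (e i)" "map e [i..<j] @ [g]" "tail G (e i)"]
    unfolding cycle_def by (intro exI[of _ "tail G (e i)"]) (auto simp: awalk_def)
qed

end

lemma sum_list_map_upt_diff:
  fixes f :: "nat \<Rightarrow> 'a :: ab_group_add"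
  assumes "i \<le> j"
  shows "(\<Sum>k\<leftarrow>[i..<j]. f k) = (\<Sum>k<j. f k) - (\<Sum>k<i. f k)"
  using assms by (induction j rule: dec_induct) auto

lemma sum_lessThan_periodic:
  fixes f :: "nat \<Rightarrow> 'a :: comm_monoid_add"
  assumes "\<And>k. f (k + m) = f k"
  shows "(\<Sum>k<i + m. f k) = (\<Sum>k<i. f k) + (\<Sum>k<m. f k)"
  by (induction i) (auto simp: assms ac_simps)

section \<open>Arcs of a valid associated digraph\<close>

text \<open>
  With the extended function the three alternatives become symmetric in the two vertices, so no
  later argument has to compare indices.
\<close>
lemma valid_associated_digraph_pair_cases:
  assumes "valid_associated_digraph n \<alpha> \<beta> G w"
    and "u \<in> {1..n}" "v \<in> {1..n}" "u \<noteq> v"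
  obtains
    (one_way) "unique_arc_of_weight G w u v (extended_beta \<alpha> \<beta> u v)" "arcs_between G v u = {}"
  | (other_way) "unique_arc_of_weight G w v u (extended_beta \<alpha> \<beta> v u)" "arcs_between G u v = {}"
  | (both_ways) c where "unique_arc_of_weight G w u v c" "unique_arc_of_weight G w v u (- c - 1)"
      "c < extended_beta \<alpha> \<beta> u v" "- c - 1 < extended_beta \<alpha> \<beta> v u"
proof -
  have "(u < v \<and> 1 \<le> u \<and> v \<le> n) \<or> (v < u \<and> 1 \<le> v \<and> u \<le> n)" using assms(2-4) by auto
  then show ?thesis
  proof
    assume uv: "u < v \<and> 1 \<le> u \<and> v \<le> n"
    then consider "backward_arc_only G w u v (\<alpha> u v)" | "arcs_both_ways G w u v (\<alpha> u v) (\<beta> u v)"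
      | "forward_arc_only G w u v (\<beta> u v)"
      using assms(1) unfolding valid_associated_digraph_def by blast
    then show ?thesis
    proof cases
      case 1
      then show ?thesis using other_way uv by (auto simp: backward_arc_only_def extended_beta_def)
    next
      case 2
      then obtain c where "c \<in> {\<alpha> u v..\<beta> u v - 1}" "unique_arc_of_weight G w u v c"
        "unique_arc_of_weight G w v u (- c - 1)" by (auto simp: arcs_both_ways_def)
      then show ?thesis using both_ways[of c] uv by (auto simp: extended_beta_def)
    next
      case 3
      then show ?thesis using one_way uv by (auto simp: forward_arc_only_def extended_beta_def)
    qed
  next
    assume vu: "v < u \<and> 1 \<le> v \<and> u \<le> n"
    then consider "backward_arc_only G w v u (\<alpha> v u)" | "arcs_both_ways G w v u (\<alpha> v u) (\<beta> v u)"
      | "forward_arc_only G w v u (\<beta> v u)"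
      using assms(1) unfolding valid_associated_digraph_def by blast
    then show ?thesis
    proof cases
      case 1
      then show ?thesis using one_way vu by (auto simp: backward_arc_only_def extended_beta_def)
    next
      case 2
      then obtain c where "c \<in> {\<alpha> v u..\<beta> v u - 1}" "unique_arc_of_weight G w v u c"
        "unique_arc_of_weight G w u v (- c - 1)" by (auto simp: arcs_both_ways_def)
      then show ?thesis using both_ways[of "- c - 1"] vu by (auto simp: extended_beta_def)
    next
      case 3
      then show ?thesis using other_way vu by (auto simp: forward_arc_only_def extended_beta_def)
    qed
  qed
qed

lemma extended_beta_pair_nonneg:
  assumes "contiguous_integral_deformation n \<alpha> \<beta> \<A>"
    and "u \<in> {1..n}" "v \<in> {1..n}" "u \<noteq> v"
  shows "0 \<le> extended_beta \<alpha> \<beta> u v + extended_beta \<alpha> \<beta> v u"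
  using assms by (auto simp: contiguous_integral_deformation_def extended_beta_def)

text \<open>
  These are the bounds that collide with the inequality on triples. The second one is needed for
  the direction in which there may be no arc: if there is none, the weight is
  $\beta(u,v) \ge -\beta(v,u)$, and otherwise the opposite arc has weight
  \<open>- w e - 1\<close>, which is less than $\beta(v,u)$.
\<close>
lemma valid_associated_digraph_arc_weight:
  assumes "contiguous_integral_deformation n \<alpha> \<beta> \<A>" "valid_associated_digraph n \<alpha> \<beta> G w"
    and uv: "u \<in> {1..n}" "v \<in> {1..n}" "u \<noteq> v"
    and e: "e \<in> arcs G" "tail G e = u" "head G e = v"
  shows "w e \<le> extended_beta \<alpha> \<beta> u v" "- w e \<le> extended_beta \<alpha> \<beta> v u"
proof -
  have e': "e \<in> arcs_between G u v" using e by (simp add: arcs_between_def)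
  have "w e \<le> extended_beta \<alpha> \<beta> u v \<and> - w e \<le> extended_beta \<alpha> \<beta> v u"
    using assms(2) uv
  proof (cases rule: valid_associated_digraph_pair_cases)
    case one_way
    then show ?thesis
      using e' extended_beta_pair_nonneg[OF assms(1) uv] by (auto simp: unique_arc_of_weight_def)
  next
    case other_way
    then show ?thesis using e' by simp
  next
    case (both_ways c)
    then show ?thesis using e' by (auto simp: unique_arc_of_weight_def)
  qed
  then show "w e \<le> extended_beta \<alpha> \<beta> u v" "- w e \<le> extended_beta \<alpha> \<beta> v u" by auto
qed

text \<open>
  Opposite arcs have weights \<open>c\<close> and \<open>- c - 1\<close>; if these are below the integers \<open>s\<close> and \<open>t\<close>, then
  their sum \<open>- 1\<close> is at most \<open>s + t - 2\<close>, so \<open>s + t > 0\<close>. In the application \<open>s\<close> and \<open>t\<close> are the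
  negated weights of the two parts into which a chord cuts a cycle of nonnegative weight.
\<close>
lemma valid_associated_digraph_one_way:
  assumes "valid_associated_digraph n \<alpha> \<beta> G w"
    and "u \<in> {1..n}" "v \<in> {1..n}" "u \<noteq> v"
    and uv: "\<And>g. g \<in> arcs G \<Longrightarrow> tail G g = u \<Longrightarrow> head G g = v \<Longrightarrow> w g < s"
    and vu: "\<And>g. g \<in> arcs G \<Longrightarrow> tail G g = v \<Longrightarrow> head G g = u \<Longrightarrow> w g < t"
    and "s + t \<le> 0"
  shows "extended_beta \<alpha> \<beta> u v < s \<or> extended_beta \<alpha> \<beta> v u < t"
proof -
  have arc_weight: "\<exists>g \<in> arcs G. tail G g = x \<and> head G g = y \<and> w g = c"
    if "unique_arc_of_weight G w x y c" for x y c
    using that by (auto simp: unique_arc_of_weight_def arcs_between_def)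
  show ?thesis
    using assms(1-4)
  proof (cases rule: valid_associated_digraph_pair_cases)
    case one_way
    then show ?thesis using arc_weight uv by metis
  next
    case other_way
    then show ?thesis using arc_weight vu by metis
  next
    case (both_ways c)
    then have "c < s" "- c - 1 < t" using arc_weight uv vu by metis+
    then show ?thesis using \<open>s + t \<le> 0\<close> by simp
  qed
qed

section \<open>Shortest ascending cycles\<close>

lemma shortest_ascending_cycle_length:
  fixes w :: "'e \<Rightarrow> int"
  assumes deformation: "contiguous_integral_deformation n \<alpha> \<beta> \<A>"
    and triangle: "\<And>i j k. i \<in> {1..n} \<Longrightarrow> j \<in> {1..n} \<Longrightarrow> k \<in> {1..n} \<Longrightarrow> i \<noteq> j \<Longrightarrow> j \<noteq> k \<Longrightarrow> i \<noteq> k \<Longrightarrow>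
           extended_beta \<alpha> \<beta> i k \<le> extended_beta \<alpha> \<beta> i j + extended_beta \<alpha> \<beta> j k + 1"
    and valid: "valid_associated_digraph n \<alpha> \<beta> G w"
    and p: "m_ascending_cycle G w p"
    and shortest: "\<And>q. m_ascending_cycle G w q \<Longrightarrow> length p \<le> length q"
  shows "length p \<le> 4"
proof (rule ccontr)
  assume "\<not> length p \<le> 4"
  define m where "m = length p"
  have m: "5 \<le> m" using \<open>\<not> length p \<le> 4\<close> by (simp add: m_def)
  interpret wf_digraph G using valid by (simp add: valid_associated_digraph_def)
  have cyc: "cycle p" and total: "0 \<le> (\<Sum>a\<leftarrow>p. w a)" using p by (auto simp: m_ascending_cycle_def)
  define e where "e = periodic_arc p"
  define v where "v i = tail G (e i)" for i
  define S where "S i = (\<Sum>k<i. w (e k))" for i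
  have e_per: "e (i + m) = e i" for i
    unfolding e_def m_def by (rule periodic_arc_add_length)
  have e_arc: "e i \<in> arcs G" and head_e: "head G (e i) = v (Suc i)" for i
    using cycle_periodic_arc_in_arcs[OF cyc] cycle_periodic_arc_head[OF cyc]
    by (simp_all add: e_def v_def)
  have dist: "v i \<noteq> v j" if "i < j" "j < i + m" for i j
    using cycle_periodic_arc_tail_neq[OF cyc] that by (simp add: v_def e_def m_def)
  have v_in: "v i \<in> {1..n}" for i
    using tail_in_verts[OF e_arc] valid by (simp add: v_def valid_associated_digraph_def)
  have S_per: "S (i + m) = S i + S m" for i
    unfolding S_def by (rule sum_lessThan_periodic) (simp add: e_per)
  have "(\<Sum>a\<leftarrow>map e [0..<m]. w a) = S m"
    by (simp add: S_def sum_list_map_upt_diff comp_def)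
  then have W: "0 \<le> S m" using total by (simp add: e_def m_def map_periodic_arc)
  \<comment> \<open>The bound \<open>j + 2 \<le> i + m\<close> makes the closed segment shorter than the cycle, so it cannot be
    ascending.\<close>
  have closing: "w g < S i - S j"
    if ij: "i < j" "j + 2 \<le> i + m" and g: "g \<in> arcs G" "tail G g = v j" "head G g = v i" for i j g
  proof (rule ccontr)
    assume "\<not> w g < S i - S j"
    moreover have "(\<Sum>a\<leftarrow>map e [i..<j]. w a) = S j - S i"
      using ij by (simp add: S_def sum_list_map_upt_diff comp_def)
    moreover have "inj_on v {i..j}"
      using dist ij by (intro linorder_inj_onI) auto
    then have "cycle (map e [i..<j] @ [g])"
      using cycle_segment_closed_by_arc[of e i j g] e_arc head_e g ij
      unfolding v_def by simp
    ultimately have "m_ascending_cycle G w (map e [i..<j] @ [g])"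
      by (simp add: m_ascending_cycle_def)
    then show False using shortest[of "map e [i..<j] @ [g]"] ij by (simp add: m_def)
  qed
  show False
  proof (rule no_long_cycle_with_one_way_chords[of m v S "S m" "extended_beta \<alpha> \<beta>"])
    show "v (i + m) = v i" for i by (simp add: v_def e_per)
    show "S (Suc i) - S i \<le> extended_beta \<alpha> \<beta> (v i) (v (Suc i))"
      "- (S (Suc i) - S i) \<le> extended_beta \<alpha> \<beta> (v (Suc i)) (v i)" for i
      using valid_associated_digraph_arc_weight[OF deformation valid v_in v_in _ e_arc _ head_e]
        dist[of i "Suc i"] m by (simp_all add: S_def v_def)
    show "extended_beta \<alpha> \<beta> (v j) (v i) \<le> - 1 - (S j - S i) \<or>
        extended_beta \<alpha> \<beta> (v i) (v j) \<le> - 1 - (S (i + m) - S j)"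
      if ij: "i + 2 \<le> j" "j + 2 \<le> i + m" for i j
    proof -
      have "extended_beta \<alpha> \<beta> (v j) (v i) < S i - S j \<or>
          extended_beta \<alpha> \<beta> (v i) (v j) < S j - S (i + m)"
      proof (rule valid_associated_digraph_one_way[OF valid v_in v_in])
        show "v j \<noteq> v i" using dist[of i j] ij by simp
        show "w g < S i - S j" if "g \<in> arcs G" "tail G g = v j" "head G g = v i" for g
          using closing[of i j g] ij that by simp
        show "w g < S j - S (i + m)" if "g \<in> arcs G" "tail G g = v i" "head G g = v j" for g
          using closing[of j "i + m" g] ij that by (simp add: v_def e_per)
        show "S i - S j + (S j - S (i + m)) \<le> 0" using S_per[of i] W by simp
      qed
      then show ?thesis by auto
    qed
  qed (use m dist S_per W triangle v_in extended_beta_pair_nonneg[OF deformation] in auto)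
qed

theorem theorem5p4:
  fixes n :: nat
    and \<alpha> \<beta> :: "nat \<Rightarrow> nat \<Rightarrow> int"
    and \<A> :: "(nat \<Rightarrow> real) set set"
    and G :: "(nat, 'e) pre_digraph"
    and w :: "'e \<Rightarrow> int"
  assumes "contiguous_integral_deformation n \<alpha> \<beta> \<A>"
    and "\<And>i j k. i \<in> {1..n} \<Longrightarrow> j \<in> {1..n} \<Longrightarrow> k \<in> {1..n} \<Longrightarrow> i \<noteq> j \<Longrightarrow> j \<noteq> k \<Longrightarrow> i \<noteq> k \<Longrightarrow>
           extended_beta \<alpha> \<beta> i k \<le> extended_beta \<alpha> \<beta> i j + extended_beta \<alpha> \<beta> j k + 1"
    and "valid_associated_digraph n \<alpha> \<beta> G w"
  shows "m_acyclic G w \<longleftrightarrow> \<not> (\<exists>p. m_ascending_cycle G w p \<and> length p \<le> 4)"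
proof -
  have "\<exists>p. m_ascending_cycle G w p \<and> length p \<le> 4" if "m_ascending_cycle G w q" for q
  proof -
    obtain p where "m_ascending_cycle G w p"
      "\<And>q. m_ascending_cycle G w q \<Longrightarrow> length p \<le> length q"
      using ex_has_least_nat[of "m_ascending_cycle G w" q length] \<open>m_ascending_cycle G w q\<close> by auto
    then show ?thesis using shortest_ascending_cycle_length[OF assms] by blast
  qed
  then show ?thesis by (auto simp: m_acyclic_def)
qed

end
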